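(* Let $f\colon\mathbb{R}_+\times X\rightarrow X$ be a $C^0$-semi flow on a compact metric space $(X,d)$. Let $x\in X$ be such that $\mathcal{C}_x$ is not generic. Then for any nonempty closed $f$-invariant subset $\Delta\subseteq\mathcal{C}_x$ there exists some point $q\in\Delta$ such that $(x,q)$ is a Li-Yorke chaotic pair for $f$.
   Context: $\mathbb{R}_+=[0,\infty)$. A $C^0$-semi flow on $X$ is a map $f\colon\mathbb{R}_+\times X\to X$ such that $f(0,x)=x$ for all $x$; $f$ is jointly continuous; and $f(t_2,f(t_1,x))=f(t_1+t_2,x)$ for all $x\in X$, $t_1,t_2\in\mathbb{R}_+$. A closed set $C\subseteq X$ is a center of attraction of the motion $f(t,x)$ if $\lim_{T\to+\infty}\frac1T\int_0^T\mathds{1}_{B_\varepsilon(C)}(f(t,x))\,dt=1$ for every $\varepsilon>0$, where $B_\varepsilon(C)$ is the $\varepsilon$-neighborhood of $C$ in $X$. The minimal center of attraction $\mathcal{C}_x$ of $f(t,x)$ is a center of attraction having no proper subset that is also a center of attraction of $f(t,x)$; it exists for every $x$ since $X$ is compact. A set $\Lambda\subseteq X$ is $f$-invariant if $f(t,y)\in\Lambda$ for all $y\in\Lambda$, $t\ge0$. An $f$-invariant set $\Lambda$ is generic if there exists $y\in\Lambda$ with $\Lambda=\mathcal{C}_y$. (Minimal centers of attraction are $f$-invariant.) Points $x,y\in X$ form a Li-Yorke chaotic pair for $f$ if $\limsup_{t\to+\infty}d(f(t,x),f(t,y))>0$ and $\liminf_{t\to+\infty}d(f(t,x),f(t,y))=0$.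 *)

theory Defs
  imports "HOL-Analysis.Analysis"
begin

text \<open>
  The phase space is the whole type \<open>'a\<close>; flows are functions on \<open>real \<Rightarrow> 'a \<Rightarrow> 'a\<close> whose values
  at negative times are irrelevant to every definition below.
\<close>

definition semiflow :: "(real \<Rightarrow> 'a::metric_space \<Rightarrow> 'a) \<Rightarrow> bool" where
  "semiflow f \<longleftrightarrow>
     (\<forall>x. f 0 x = x) \<and>
     continuous_on ({0..} \<times> UNIV) (\<lambda>(t, x). f t x) \<and>
     (\<forall>x. \<forall>t1\<ge>0. \<forall>t2\<ge>0. f t2 (f t1 x) = f (t1 + t2) x)"

definition nbhd :: "real \<Rightarrow> 'a::metric_space set \<Rightarrow> 'a set" where
  "nbhd \<epsilon> C = (\<Union>c\<in>C. ball c \<epsilon>)"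

definition center_of_attraction ::
  "(real \<Rightarrow> 'a::metric_space \<Rightarrow> 'a) \<Rightarrow> 'a \<Rightarrow> 'a set \<Rightarrow> bool" where
  "center_of_attraction f x C \<longleftrightarrow>
     closed C \<and>
     (\<forall>\<epsilon>>0. ((\<lambda>T. 1 / T * (LBINT t:{0..T}. indicat_real (nbhd \<epsilon> C) (f t x))) \<longlongrightarrow> 1) at_top)"

definition is_minimal_center ::
  "(real \<Rightarrow> 'a::metric_space \<Rightarrow> 'a) \<Rightarrow> 'a \<Rightarrow> 'a set \<Rightarrow> bool" where
  "is_minimal_center f x C \<longleftrightarrow>
     center_of_attraction f x C \<and> (\<forall>D. D \<subset> C \<longrightarrow> \<not> center_of_attraction f x D)"

text \<open>
  For a semiflow on a compact space the description below is proper: the set of all \<open>y\<close> such that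
  the motion visits every ball around \<open>y\<close> with positive upper density is a center of attraction and
  is contained in every other one, so it is the unique minimal one.
\<close>

definition minimal_center :: "(real \<Rightarrow> 'a::metric_space \<Rightarrow> 'a) \<Rightarrow> 'a \<Rightarrow> 'a set" where
  "minimal_center f x = (THE C. is_minimal_center f x C)"

definition flow_invariant :: "(real \<Rightarrow> 'a \<Rightarrow> 'a) \<Rightarrow> 'a set \<Rightarrow> bool" where
  "flow_invariant f \<Lambda> \<longleftrightarrow> (\<forall>y\<in>\<Lambda>. \<forall>t\<ge>0. f t y \<in> \<Lambda>)"

definition generic_set :: "(real \<Rightarrow> 'a::metric_space \<Rightarrow> 'a) \<Rightarrow> 'a set \<Rightarrow> bool" where
  "generic_set f \<Lambda> \<longleftrightarrow> flow_invariant f \<Lambda> \<and> (\<exists>y\<in>\<Lambda>. \<Lambda> = minimal_center f y)"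

text \<open>
  Upper and lower limits are taken in \<^typ>\<open>ereal\<close>, since \<^const>\<open>Limsup\<close> and \<^const>\<open>Liminf\<close> need a
  complete lattice.
\<close>

definition li_yorke_pair :: "(real \<Rightarrow> 'a::metric_space \<Rightarrow> 'a) \<Rightarrow> 'a \<Rightarrow> 'a \<Rightarrow> bool" where
  "li_yorke_pair f x y \<longleftrightarrow>
     Limsup at_top (\<lambda>t. ereal (dist (f t x) (f t y))) > 0 \<and>
     Liminf at_top (\<lambda>t. ereal (dist (f t x) (f t y))) = 0"

end

theory Submission
  imports Defs
begin

text \<open>
  Visit frequencies identify the minimal center of \<open>x\<close> with the set of all points each of whose
  balls is visited by the motion of \<open>x\<close> with nonzero upper density. Hence it is invariant, it is
  contained in the closure of the orbit, and asymptotic points share it. The pointwise closure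
  \<open>E\<close> of the maps \<open>f t\<close> is a compact right topological semigroup, and the members of \<open>E\<close> that move
  \<open>x\<close> into \<open>\<Delta>\<close> form a nonempty closed subsemigroup, which contains an idempotent \<open>u\<close> (Ellis and
  Numakura). For \<open>q = u x\<close> we have \<open>u q = u x\<close>, so \<open>x\<close> and \<open>q\<close> are proximal (Auslander and Ellis).
  If their distance tended to \<open>0\<close>, then the minimal center of \<open>x\<close> would be that of its own member
  \<open>q\<close>, that is, it would be generic.
\<close>

section \<open>Idempotents in compact right topological semigroups\<close>

text \<open>
  Function spaces cannot be made an instance of \<^class>\<open>t2_space\<close>, since the arities would conflict
  with the metric on functions of a countable argument; so the Hausdorff property is a hypothesis.
\<close>

lemma Hausdorff_space_fun: "Hausdorff_space (euclidean :: ('a \<Rightarrow> 'b::metric_space) topology)"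
proof -
  have "Hausdorff_space (product_topology (\<lambda>_::'a. euclidean :: 'b topology) UNIV)"
    by (simp add: Hausdorff_space_product_topology)
  then show ?thesis by (simp add: euclidean_product_topology)
qed

lemma compact_imp_closed_Hausdorff:
  fixes S :: "'a::topological_space set"
  shows "Hausdorff_space (euclidean :: 'a topology) \<Longrightarrow> compact S \<Longrightarrow> closed S"
  using compactin_imp_closedin[of "euclidean :: 'a topology" S] by simp

text \<open>Tychonoff's theorem: the function type carries the product topology, that is, pointwise
  convergence.\<close>

lemma compact_UNIV_fun:
  assumes "compact (UNIV :: 'b::topological_space set)"
  shows "compact (UNIV :: ('a \<Rightarrow> 'b) set)"
proof -
  have "compact_space (product_topology (\<lambda>_::'a. euclidean :: 'b topology) UNIV)"
    using assms unfolding compact_space_product_topology by (simp add: compact_space_def)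
  then show ?thesis
    by (simp add: euclidean_product_topology compact_space_def)
qed

text \<open>A finite nonempty subfamily of a chain has its intersection in the family, as its least
  member. So the finite intersection property applies inside one compact member.\<close>

lemma Inter_chain_compact_nonempty:
  fixes F :: "'a::topological_space set set"
  assumes haus: "Hausdorff_space (euclidean :: 'a topology)"
    and ne: "F \<noteq> {}"
    and comp: "\<And>T. T \<in> F \<Longrightarrow> compact T \<and> T \<noteq> {}"
    and chain: "\<And>S T. S \<in> F \<Longrightarrow> T \<in> F \<Longrightarrow> S \<subseteq> T \<or> T \<subseteq> S"
  shows "\<Inter>F \<noteq> {}"
proof -
  obtain S where S: "S \<in> F" using ne by blast
  have fin: "\<Inter>G \<in> F" if "finite G" "G \<noteq> {}" "G \<subseteq> F" for G
    using that
  proof (induction rule: finite_ne_induct)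
    case (insert T G)
    then show ?case using chain[of T "\<Inter>G"] by (auto simp: inf.absorb1 inf.absorb2)
  qed auto
  have "S \<inter> \<Inter>F \<noteq> {}"
  proof (rule compact_imp_fip)
    show "S \<inter> \<Inter>G \<noteq> {}" if "finite G" "G \<subseteq> F" for G
      using fin[of "insert S G"] that S comp by auto
  qed (use S comp compact_imp_closed_Hausdorff[OF haus] in auto)
  then show ?thesis by blast
qed

text \<open>Take a minimal compact subsemigroup \<open>A\<close> and \<open>u\<close> in it.
  Minimality forces A u = A, so the stabilizer of \<open>u\<close> in \<open>A\<close> is nonempty.
  It is again a compact subsemigroup, hence all of \<open>A\<close>, and so contains
  \<open>u\<close> itself.\<close>

lemma Ellis_Numakura:
  fixes m :: "'a::topological_space \<Rightarrow> 'a \<Rightarrow> 'a"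
  assumes haus: "Hausdorff_space (euclidean :: 'a topology)"
    and S: "compact S" "S \<noteq> {}"
    and closed_m: "\<And>p q. p \<in> S \<Longrightarrow> q \<in> S \<Longrightarrow> m p q \<in> S"
    and assoc: "\<And>p q r. m (m p q) r = m p (m q r)"
    and cont: "\<And>q. continuous_on S (\<lambda>p. m p q)"
  obtains u where "u \<in> S" "m u u = u"
proof -
  define \<A> where "\<A> = {A. A \<subseteq> S \<and> compact A \<and> A \<noteq> {} \<and> (\<forall>p\<in>A. \<forall>q\<in>A. m p q \<in> A)}"
  \<comment> \<open>Zorn's lemma for reverse inclusion: a chain is bounded by its intersection, or
    by \<open>S\<close> when it is empty.\<close>
  have "\<exists>A\<in>\<A>. \<forall>B\<in>\<A>. A \<supseteq> B \<longrightarrow> B = A"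
  proof (rule predicate_Zorn)
    show "partial_order_on \<A> (relation_of (\<supseteq>) \<A>)"
      by (rule partial_order_on_relation_ofI) auto
    fix C assume C: "C \<in> Chains (relation_of (\<supseteq>) \<A>)"
    then have CA: "C \<subseteq> \<A>" and ch: "\<And>S T. S \<in> C \<Longrightarrow> T \<in> C \<Longrightarrow> S \<subseteq> T \<or> T \<subseteq> S"
      by (auto simp: Chains_def relation_of_def)
    show "\<exists>A\<in>\<A>. \<forall>B\<in>C. A \<subseteq> B"
    proof (cases "C = {}")
      case True
      then show ?thesis using S closed_m by (auto simp: \<A>_def)
    next
      case False
      have "\<Inter>C \<noteq> {}"
        using CA ch by (intro Inter_chain_compact_nonempty[OF haus False]) (auto simp: \<A>_def)
      moreover have "compact (\<Inter>C)"
      proof -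
        obtain B where B: "B \<in> C" using False by blast
        have "compact (B \<inter> \<Inter>C)"
          using CA B compact_imp_closed_Hausdorff[OF haus]
          by (intro compact_Int_closed closed_Inter) (auto simp: \<A>_def)
        moreover have "B \<inter> \<Inter>C = \<Inter>C" using B by blast
        ultimately show ?thesis by simp
      qed
      moreover have "\<Inter>C \<subseteq> S" using CA False unfolding \<A>_def by blast
      moreover have "m p q \<in> \<Inter>C" if "p \<in> \<Inter>C" "q \<in> \<Inter>C" for p q
        using that CA by (auto simp: \<A>_def)
      ultimately have "\<Inter>C \<in> \<A>" unfolding \<A>_def by blast
      then show ?thesis by blast
    qed
  qed
  then obtain A where A: "A \<in> \<A>" and min: "\<And>B. B \<in> \<A> \<Longrightarrow> B \<subseteq> A \<Longrightarrow> B = A" by blast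
  have AS: "A \<subseteq> S" "compact A" "A \<noteq> {}" and mA: "\<And>p q. p \<in> A \<Longrightarrow> q \<in> A \<Longrightarrow> m p q \<in> A"
    using A by (auto simp: \<A>_def)
  obtain u where u: "u \<in> A" using AS by blast
  have contA: "continuous_on A (\<lambda>p. m p u)" using cont AS continuous_on_subset by blast
  have "(\<lambda>p. m p u) ` A \<in> \<A>"
    unfolding \<A>_def
  proof (intro CollectI conjI ballI)
    show "compact ((\<lambda>p. m p u) ` A)" using compact_continuous_image[OF contA] AS by simp
    fix p q assume "p \<in> (\<lambda>p. m p u) ` A" "q \<in> (\<lambda>p. m p u) ` A"
    then obtain r s where "r \<in> A" "s \<in> A" "p = m r u" "q = m s u" by blast
    \<comment> \<open>By associativity (r u)(s u) = ((r u) s) u, and (r u) s lies in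
      \<open>A\<close>.\<close>
    then show "m p q \<in> (\<lambda>p. m p u) ` A"
      using mA u by (intro image_eqI[of _ _ "m (m r u) s"]) (auto simp: assoc)
  qed (use AS u mA in blast)+
  then have "(\<lambda>p. m p u) ` A = A" using min mA u by blast
  then obtain v where v: "v \<in> A" "m v u = u" using u by (metis imageE)
  define B where "B = {p \<in> A. m p u = u}"
  have "B \<in> \<A>"
    unfolding \<A>_def
  proof (intro CollectI conjI ballI)
    have "closedin (top_of_set A) (A \<inter> (\<lambda>p. m p u) -` {u})"
      by (rule continuous_closedin_preimage[OF contA compact_imp_closed_Hausdorff[OF haus]]) simp
    moreover have "A \<inter> (\<lambda>p. m p u) -` {u} = B" by (auto simp: B_def)
    ultimately have "closedin (top_of_set A) B" by simp
    then show "compact B" using AS closedin_compact by blast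
    fix p q assume "p \<in> B" "q \<in> B"
    then show "m p q \<in> B" using mA assoc by (auto simp: B_def)
  qed (use v AS in \<open>auto simp: B_def\<close>)
  then have "B = A" using min by (auto simp: B_def)
  then have "m u u = u" using u by (auto simp: B_def)
  then show ?thesis using that u AS by blast
qed

section \<open>Proximal points\<close>

text \<open>The value of \<open>p \<circ> q\<close> at a point is a coordinate of \<open>p\<close>,
  so continuity in \<open>p\<close> holds for every \<open>q\<close>, continuous or not. This is
  what makes composition right topological.\<close>

lemma continuous_on_comp_right: "continuous_on S (\<lambda>p :: 'b \<Rightarrow> 'c::topological_space. p \<circ> q)"
  by (intro continuous_on_coordinatewise_then_product)
    (auto intro: continuous_on_subset[OF continuous_on_product_coordinates])

lemma fmeasurable_Icc: "{a..b::real} \<in> fmeasurable lborel"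
  by (intro fmeasurableI) (simp_all add: emeasure_lborel_Icc_eq)

locale compact_semiflow =
  fixes f :: "real \<Rightarrow> 'a::metric_space \<Rightarrow> 'a"
  assumes compact_UNIV: "compact (UNIV :: 'a set)"
    and semiflow: "semiflow f"
begin

lemma flow_add: "s \<ge> 0 \<Longrightarrow> t \<ge> 0 \<Longrightarrow> f t (f s x) = f (s + t) x"
  using semiflow unfolding semiflow_def by blast

lemma continuous_on_orbit: "continuous_on {0..} (\<lambda>t. f t x)"
proof -
  have "continuous_on {0..} ((\<lambda>(t, x). f t x) \<circ> (\<lambda>t. (t, x)))"
    using semiflow unfolding semiflow_def
    by (intro continuous_on_compose continuous_intros) (auto elim: continuous_on_subset)
  then show ?thesis by (simp add: o_def)
qed

lemma continuous_on_time_map: "t \<ge> 0 \<Longrightarrow> continuous_on UNIV (f t)"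
proof -
  assume "t \<ge> 0"
  then have "continuous_on UNIV ((\<lambda>(t, x). f t x) \<circ> (\<lambda>x. (t, x)))"
    using semiflow unfolding semiflow_def
    by (intro continuous_on_compose continuous_intros) (auto elim: continuous_on_subset)
  then show ?thesis by (simp add: o_def)
qed

text \<open>The Ellis semigroup. The closure is taken in pointwise convergence, so its members may
  be discontinuous.\<close>

definition enveloping_semigroup :: "('a \<Rightarrow> 'a) set" where
  "enveloping_semigroup = closure (f ` {0..})"

lemma compact_enveloping_semigroup: "compact enveloping_semigroup"
  using closed_Int_compact[OF closed_closure compact_UNIV_fun[OF compact_UNIV]]
  by (simp add: enveloping_semigroup_def)

text \<open>Limits are taken one factor at a time: first on the right of a continuous
  \<open>f t\<close>, then on the left of a fixed \<open>q\<close>.\<close>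

lemma enveloping_semigroup_comp:
  assumes p: "p \<in> enveloping_semigroup" and q: "q \<in> enveloping_semigroup"
  shows "p \<circ> q \<in> enveloping_semigroup"
proof -
  have left: "f t \<circ> r \<in> enveloping_semigroup" if t: "t \<ge> 0" and r: "r \<in> enveloping_semigroup" for t r
  proof -
    have "continuous_on UNIV (\<lambda>r::'a \<Rightarrow> 'a. f t (r i))" for i
      by (rule continuous_on_compose2[OF continuous_on_time_map[OF t] continuous_on_product_coordinates]) simp
    then have "continuous_on UNIV (\<lambda>r::'a \<Rightarrow> 'a. f t \<circ> r)"
      by (intro continuous_on_coordinatewise_then_product) (simp add: o_def)
    then have cont: "continuous_on (closure (f ` {0..})) (\<lambda>r. f t \<circ> r)"
      by (rule continuous_on_subset) simp
    have "f t \<circ> f s = f (s + t)" if "s \<ge> 0" for s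
      using flow_add[OF that t] by (simp add: fun_eq_iff)
    then have "(\<lambda>r. f t \<circ> r) ` f ` {0..} \<subseteq> f ` {0..}"
      using t by auto
    then have "(\<lambda>r. f t \<circ> r) ` f ` {0..} \<subseteq> enveloping_semigroup"
      unfolding enveloping_semigroup_def by (rule order.trans[OF _ closure_subset])
    from image_closure_subset[OF cont _ this] r show ?thesis
      by (auto simp: enveloping_semigroup_def)
  qed
  have "(\<lambda>p. p \<circ> q) ` f ` {0..} \<subseteq> enveloping_semigroup" using left q by auto
  from image_closure_subset[OF continuous_on_comp_right _ this] p show ?thesis
    by (auto simp: enveloping_semigroup_def)
qed

text \<open>Evaluation at \<open>y\<close> is continuous, so membership in the closed set passes
  from the maps \<open>f t\<close> to their limits.\<close>

lemma enveloping_semigroup_invariant: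
  assumes "closed \<Delta>" "flow_invariant f \<Delta>" "p \<in> enveloping_semigroup" "y \<in> \<Delta>"
  shows "p y \<in> \<Delta>"
proof -
  have "(\<lambda>p. p y) ` f ` {0..} \<subseteq> \<Delta>" using assms by (auto simp: flow_invariant_def)
  from image_closure_subset[OF continuous_on_subset[OF continuous_on_product_coordinates] assms(1) this]
  show ?thesis using assms(3) by (auto simp: enveloping_semigroup_def)
qed

text \<open>The evaluation image of the compact semigroup is closed and contains the orbit; the
  converse inclusion is continuity of evaluation. Thus every limit point of the orbit is the value
  at \<open>x\<close> of some limit map.\<close>

lemma orbit_closure_eq: "closure ((\<lambda>t. f t x) ` {0..}) = (\<lambda>p. p x) ` enveloping_semigroup"
proof
  have cont: "continuous_on A (\<lambda>p::'a \<Rightarrow> 'a. p x)" for A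
    by (rule continuous_on_subset[OF continuous_on_product_coordinates]) simp
  have "compact ((\<lambda>p. p x) ` enveloping_semigroup)"
    using compact_continuous_image[OF cont compact_enveloping_semigroup] .
  moreover have "(\<lambda>t. f t x) ` {0..} \<subseteq> (\<lambda>p. p x) ` enveloping_semigroup"
    unfolding enveloping_semigroup_def using closure_subset[of "f ` {0..}"] by auto
  ultimately show "closure ((\<lambda>t. f t x) ` {0..}) \<subseteq> (\<lambda>p. p x) ` enveloping_semigroup"
    by (simp add: closure_minimal compact_imp_closed)
  have "(\<lambda>p. p x) ` f ` {0..} \<subseteq> closure ((\<lambda>t. f t x) ` {0..})"
    by (simp add: image_image closure_subset)
  from image_closure_subset[OF cont closed_closure this]
  show "(\<lambda>p. p x) ` enveloping_semigroup \<subseteq> closure ((\<lambda>t. f t x) ` {0..})"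
    by (simp add: enveloping_semigroup_def)
qed

theorem Auslander_Ellis:
  assumes \<Delta>: "closed \<Delta>" "flow_invariant f \<Delta>"
    and meets: "\<Delta> \<inter> closure ((\<lambda>t. f t x) ` {0..}) \<noteq> {}"
  obtains q where "q \<in> \<Delta>" "\<And>e. e > 0 \<Longrightarrow> \<exists>t\<ge>0. dist (f t x) (f t q) < e"
proof -
  define A where "A = {p \<in> enveloping_semigroup. p x \<in> \<Delta>}"
  have "A = enveloping_semigroup \<inter> (\<lambda>p. p x) -` \<Delta>" by (auto simp: A_def)
  moreover have "closed ((\<lambda>p::'a \<Rightarrow> 'a. p x) -` \<Delta>)"
    using \<Delta>(1) by (intro closed_vimage continuous_on_product_coordinates)
  ultimately have "compact A"
    using compact_Int_closed compact_enveloping_semigroup by auto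
  moreover have "A \<noteq> {}"
    using meets by (auto simp: orbit_closure_eq A_def)
  \<comment> \<open>Since \<open>q x\<close> lies in \<open>\<Delta>\<close>, invariance under the
    semigroup keeps \<open>p (q x)\<close> there.\<close>
  moreover have "p \<circ> q \<in> A" if "p \<in> A" "q \<in> A" for p q
    using that enveloping_semigroup_comp enveloping_semigroup_invariant[OF \<Delta>] by (auto simp: A_def)
  ultimately obtain u where u: "u \<in> A" "u \<circ> u = u"
    by (rule Ellis_Numakura[OF Hausdorff_space_fun, where m = "(\<circ>)"]) (auto simp: comp_assoc continuous_on_comp_right)
  then have E: "u \<in> closure (f ` {0..})" and q: "u x \<in> \<Delta>"
    by (auto simp: A_def enveloping_semigroup_def)
  have "\<exists>t\<ge>0. dist (f t x) (f t (u x)) < e" if "e > 0" for e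
  proof -
    \<comment> \<open>A neighbourhood of \<open>u\<close> in pointwise convergence can constrain the
      values at \<open>x\<close> and at \<open>u x\<close> at once. The idempotent sends both points
      to \<open>u x\<close>, so a single \<open>f t\<close> brings both within \<open>e/2\<close> of
      it.\<close>
    let ?W = "(\<lambda>p::'a \<Rightarrow> 'a. p x) -` ball (u x) (e/2) \<inter> (\<lambda>p. p (u x)) -` ball (u x) (e/2)"
    have "open ?W"
      by (intro open_Int open_vimage open_ball continuous_on_product_coordinates)
    moreover have "u \<in> ?W" using u(2) that by (simp add: fun_eq_iff)
    ultimately obtain t where "t \<ge> 0" "f t \<in> ?W"
      using E unfolding closure_iff_nhds_not_empty by blast
    then show ?thesis
      using dist_triangle_half_r[of "u x" "f t x" e "f t (u x)"] by (auto simp: dist_commute)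
  qed
  with q show ?thesis by (rule that)
qed

section \<open>Visit frequencies and minimal centers\<close>

definition visit_freq :: "'a \<Rightarrow> 'a set \<Rightarrow> real \<Rightarrow> real" where
  "visit_freq x U T = measure lborel {t \<in> {0..T}. f t x \<in> U} / T"

lemma set_integral_eq_visit_freq:
  "1 / T * (LBINT t:{0..T}. indicat_real U (f t x)) = visit_freq x U T"
proof -
  have "(LBINT t:{0..T}. indicat_real U (f t x)) = integral\<^sup>L lborel (indicat_real {t \<in> {0..T}. f t x \<in> U})"
    unfolding set_lebesgue_integral_def
    by (intro Bochner_Integration.integral_cong) (auto simp: indicator_def)
  then show ?thesis by (simp add: visit_freq_def)
qed

text \<open>Continuity of the orbit makes the visit times relatively open in a bounded
  interval.\<close>

lemma fmeasurable_visits: "open U \<Longrightarrow> {t \<in> {0..T}. f t x \<in> U} \<in> fmeasurable lborel"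
proof -
  assume "open U"
  moreover have "continuous_on {0..T} (\<lambda>t. f t x)"
    using continuous_on_subset[OF continuous_on_orbit] by auto
  ultimately obtain V where V: "open V" "V \<inter> {0..T} = (\<lambda>t. f t x) -` U \<inter> {0..T}"
    unfolding continuous_on_open_invariant by blast
  then have "{t \<in> {0..T}. f t x \<in> U} = {0..T} \<inter> V" by blast
  moreover have "{0..T} \<inter> V \<in> fmeasurable lborel"
    using V(1) by (intro fmeasurable_Int_fmeasurable fmeasurable_Icc) auto
  ultimately show ?thesis by (rule ssubst)
qed

lemma visit_freq_bounds: "open U \<Longrightarrow> T > 0 \<Longrightarrow> 0 \<le> visit_freq x U T \<and> visit_freq x U T \<le> 1"
proof -
  assume "open U" "T > 0"
  then have "measure lborel {t \<in> {0..T}. f t x \<in> U} \<le> measure lborel {0..T}"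
    by (intro measure_mono_fmeasurable fmeasurable_Icc fmeasurableD[OF fmeasurable_visits]) auto
  with \<open>T > 0\<close> show ?thesis by (simp add: visit_freq_def)
qed

lemma visit_freq_subadditive:
  assumes "open U" "open V" "open W" "T > 0" "W \<subseteq> U \<union> V"
  shows "visit_freq x W T \<le> visit_freq x U T + visit_freq x V T"
proof -
  let ?M = "\<lambda>U. {t \<in> {0..T}. f t x \<in> U}"
  have "measure lborel (?M W) \<le> measure lborel (?M U \<union> ?M V)"
    using assms
    by (intro measure_mono_fmeasurable fmeasurable.Un fmeasurableD[OF fmeasurable_visits] fmeasurable_visits)
      auto
  also have "\<dots> \<le> measure lborel (?M U) + measure lborel (?M V)"
    using assms by (intro measure_Un_le fmeasurableD[OF fmeasurable_visits])
  finally show ?thesis using assms by (simp add: visit_freq_def divide_simps)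
qed

text \<open>Visits of \<open>x\<close> between times s and T - r, delayed by \<open>r\<close>, are
  visits of \<open>y\<close> up to time \<open>T\<close>. The remaining times lie in two intervals
  of total length s + r, and translation preserves Lebesgue measure.\<close>

lemma visit_freq_shift:
  assumes "open U" "open V" "T > 0" "s \<ge> 0" "r \<ge> 0"
    and "\<And>t. t \<ge> s \<Longrightarrow> f t x \<in> U \<Longrightarrow> f (t + r) y \<in> V"
  shows "visit_freq x U T \<le> visit_freq y V T + (s + r) / T"
proof -
  let ?A = "{t \<in> {0..T}. f t x \<in> U}"
  let ?B = "{t \<in> {0..T}. f t y \<in> V}"
  have AB: "?A \<subseteq> ({0..s} \<union> {T-r..T}) \<union> (\<lambda>t. t - r) ` ?B"
  proof
    fix t assume t: "t \<in> ?A"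
    show "t \<in> ({0..s} \<union> {T-r..T}) \<union> (\<lambda>t. t - r) ` ?B"
    proof (cases "s \<le> t \<and> t \<le> T - r")
      case True
      then have "t + r \<in> ?B" using t assms by auto
      then show ?thesis by (force intro: image_eqI[of _ _ "t + r"])
    qed (use t in auto)
  qed
  have fB: "?B \<in> fmeasurable lborel" using fmeasurable_visits assms by blast
  have B': "(\<lambda>t. t - r) ` ?B = (\<lambda>t. t + r) -` ?B" by force
  have eqB: "emeasure lborel ((\<lambda>t. t + r) -` ?B) = emeasure lborel ?B"
  proof -
    have "emeasure lborel ?B = emeasure (distr lborel borel ((+) r)) ?B"
      using lborel_distr_plus[of r] by simp
    also have "\<dots> = emeasure lborel ((+) r -` ?B \<inter> space lborel)"
      using fB by (intro emeasure_distr) (auto simp: fmeasurable_def)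
    finally show ?thesis by (simp add: vimage_def add.commute)
  qed
  have sB: "(\<lambda>t. t + r) -` ?B \<in> sets lborel"
    using measurable_sets[of "\<lambda>t. t + r" lborel lborel ?B] fmeasurableD[OF fB] by simp
  then have fB': "(\<lambda>t. t + r) -` ?B \<in> fmeasurable lborel"
    using fB eqB by (simp add: fmeasurable_def)
  have "measure lborel ?A \<le> measure lborel (({0..s} \<union> {T-r..T}) \<union> (\<lambda>t. t + r) -` ?B)"
    using AB fB' assms(1) unfolding B'
    by (intro measure_mono_fmeasurable fmeasurable.Un fmeasurable_Icc fmeasurableD[OF fmeasurable_visits])
  also have "\<dots> \<le> measure lborel ({0..s} \<union> {T-r..T}) + measure lborel ((\<lambda>t. t + r) -` ?B)"
    using sB by (intro measure_Un_le) auto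
  also have "\<dots> \<le> (measure lborel {0..s} + measure lborel {T-r..T}) + measure lborel ?B"
    using measure_Un_le[of "{0..s}" lborel "{T-r..T}"] eqB by (simp add: measure_def)
  also have "\<dots> = s + r + measure lborel ?B" using assms by simp
  finally show ?thesis using assms(3) by (simp add: visit_freq_def divide_simps)
qed

text \<open>For open \<open>U\<close> the frequencies are nonnegative at positive times, so the
  limit 0 says that the upper density is zero.\<close>

definition negligible_visits :: "'a \<Rightarrow> 'a set \<Rightarrow> bool" where
  "negligible_visits x U \<longleftrightarrow> (visit_freq x U \<longlongrightarrow> 0) at_top"

text \<open>One comparison with three uses: s = r = 0 gives monotonicity, a delay \<open>r\<close>
  follows the flow, and a late start \<open>s\<close> handles asymptotic orbits. The error
  \<open>(s + r) / T\<close> vanishes.\<close>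

lemma negligible_visits_transfer:
  assumes "negligible_visits y V" "open U" "open V" "s \<ge> 0" "r \<ge> 0"
    and "\<And>t. t \<ge> s \<Longrightarrow> f t x \<in> U \<Longrightarrow> f (t + r) y \<in> V"
  shows "negligible_visits x U"
  unfolding negligible_visits_def
proof (rule tendsto_sandwich)
  show "\<forall>\<^sub>F T in at_top. 0 \<le> visit_freq x U T"
    using eventually_gt_at_top[of 0] by eventually_elim (use visit_freq_bounds assms open_Un in blast)
  show "\<forall>\<^sub>F T in at_top. visit_freq x U T \<le> visit_freq y V T + (s + r) / T"
    using eventually_gt_at_top[of 0] by eventually_elim (use visit_freq_shift assms in auto)
  have "((\<lambda>T. (s + r) / T) \<longlongrightarrow> 0) at_top"
    by (intro tendsto_divide_0[OF tendsto_const] filterlim_at_top_imp_at_infinity filterlim_ident)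
  then show "((\<lambda>T. visit_freq y V T + (s + r) / T) \<longlongrightarrow> 0) at_top"
    using tendsto_add assms(1) unfolding negligible_visits_def by fastforce
qed simp

lemma negligible_visits_Un:
  assumes "negligible_visits x U" "negligible_visits x V" "open U" "open V"
  shows "negligible_visits x (U \<union> V)"
  unfolding negligible_visits_def
proof (rule tendsto_sandwich)
  show "\<forall>\<^sub>F T in at_top. 0 \<le> visit_freq x (U \<union> V) T"
    using eventually_gt_at_top[of 0] by eventually_elim (use visit_freq_bounds assms open_Un in blast)
  show "\<forall>\<^sub>F T in at_top. visit_freq x (U \<union> V) T \<le> visit_freq x U T + visit_freq x V T"
    using eventually_gt_at_top[of 0] by eventually_elim (rule visit_freq_subadditive; use assms in auto)
  show "((\<lambda>T. visit_freq x U T + visit_freq x V T) \<longlongrightarrow> 0) at_top"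
    using tendsto_add assms(1,2) unfolding negligible_visits_def by fastforce
qed simp

lemma negligible_visits_empty: "negligible_visits x {}"
proof -
  have "visit_freq x {} = (\<lambda>_. 0)" by (simp add: visit_freq_def fun_eq_iff)
  then show ?thesis by (simp add: negligible_visits_def)
qed

lemma negligible_visits_UNION:
  assumes "finite I" "\<And>i. i \<in> I \<Longrightarrow> open (U i) \<and> negligible_visits x (U i)"
  shows "negligible_visits x (\<Union>i\<in>I. U i)"
  using assms
proof (induction rule: finite_induct)
  case (insert i I)
  then have "negligible_visits x (U i \<union> (\<Union>i\<in>I. U i))"
    by (intro negligible_visits_Un open_UN) blast+
  then show ?case by simp
qed (simp add: negligible_visits_empty)

section \<open>Explicit description of the minimal center\<close>

definition recurrent_center :: "'a \<Rightarrow> 'a set" where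
  "recurrent_center x = {y. \<forall>e>0. \<not> negligible_visits x (ball y e)}"

lemma open_nbhd: "open (nbhd e C)"
  by (auto simp: nbhd_def)

lemma center_of_attraction_iff:
  "center_of_attraction f x C \<longleftrightarrow> closed C \<and> (\<forall>e>0. (visit_freq x (nbhd e C) \<longlongrightarrow> 1) at_top)"
  unfolding center_of_attraction_def set_integral_eq_visit_freq ..

lemma closed_recurrent_center: "closed (recurrent_center x)"
  unfolding closed_def open_contains_ball
proof
  fix y assume "y \<in> - recurrent_center x"
  then obtain e where e: "e > 0" "negligible_visits x (ball y e)" by (auto simp: recurrent_center_def)
  have "z \<in> - recurrent_center x" if "z \<in> ball y (e/2)" for z
  proof -
    have "ball z (e/2) \<subseteq> ball y e" using that dist_triangle_half_r[of z y e] by (auto simp: dist_commute)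
    then have "negligible_visits x (ball z (e/2))"
      by (intro negligible_visits_transfer[OF e(2), of _ 0 0]) (simp_all add: subset_iff)
    then show ?thesis using e(1) by (auto simp: recurrent_center_def intro!: exI[of _ "e/2"])
  qed
  then show "\<exists>e>0. ball y e \<subseteq> - recurrent_center x" using e(1) by (intro exI[of _ "e/2"]) auto
qed

text \<open>By compactness, finitely many balls with negligible visits cover the complement of the
  neighborhood, so the time spent there has frequency tending to 0.\<close>

lemma center_of_attraction_recurrent_center: "center_of_attraction f x (recurrent_center x)"
  unfolding center_of_attraction_iff
proof (intro conjI allI impI closed_recurrent_center)
  fix e :: real assume e: "e > 0"
  let ?N = "nbhd e (recurrent_center x)"
  define r where "r y = (SOME r. r > 0 \<and> negligible_visits x (ball y r))" for y
  have r: "r y > 0 \<and> negligible_visits x (ball y (r y))" if "y \<in> - ?N" for y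
  proof -
    have "y \<notin> recurrent_center x" using that e by (auto simp: nbhd_def)
    then have "\<exists>r>0. negligible_visits x (ball y r)" by (auto simp: recurrent_center_def)
    then show ?thesis unfolding r_def by (rule someI_ex)
  qed
  have "compact (- ?N)"
    using closed_Int_compact[OF closed_Compl[OF open_nbhd] compact_UNIV] by simp
  moreover have "- ?N \<subseteq> (\<Union>y\<in>- ?N. ball y (r y))"
    using r by (intro subsetI UN_I) (assumption, simp add: centre_in_ball)
  ultimately obtain I where I: "I \<subseteq> - ?N" "finite I" "- ?N \<subseteq> (\<Union>y\<in>I. ball y (r y))"
    by (rule compactE_image[OF _ open_ball])
  let ?U = "\<Union>y\<in>I. ball y (r y)"
  have negl: "negligible_visits x ?U" using I r by (intro negligible_visits_UNION) auto
  show "(visit_freq x ?N \<longlongrightarrow> 1) at_top"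
  proof (rule tendsto_sandwich)
    show "\<forall>\<^sub>F T in at_top. 1 - visit_freq x ?U T \<le> visit_freq x ?N T"
      using eventually_gt_at_top[of 0]
    proof eventually_elim
      fix T :: real assume T: "T > 0"
      \<comment> \<open>The finite cover and the neighborhood together exhaust the space, whose
        frequency is 1.\<close>
      have "visit_freq x UNIV T \<le> visit_freq x ?U T + visit_freq x ?N T"
        using I T open_nbhd by (intro visit_freq_subadditive) auto
      moreover have "visit_freq x UNIV T = 1"
      proof -
        have "{t \<in> {0..T}. f t x \<in> UNIV} = {0..T}" by blast
        then show ?thesis using T by (simp only: visit_freq_def) simp
      qed
      ultimately show "1 - visit_freq x ?U T \<le> visit_freq x ?N T" by simp
    qed
    show "\<forall>\<^sub>F T in at_top. visit_freq x ?N T \<le> 1"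
      using eventually_gt_at_top[of 0] by eventually_elim (use visit_freq_bounds[OF open_nbhd] in blast)
    show "((\<lambda>T. 1 - visit_freq x ?U T) \<longlongrightarrow> 1) at_top"
      using tendsto_diff[OF tendsto_const negl[unfolded negligible_visits_def], of 1] by simp
  qed simp
qed

text \<open>A point outside \<open>C\<close> has a ball disjoint from some neighborhood of
  \<open>C\<close>. That neighborhood is visited with frequency tending to 1, which leaves frequency
  0 for the ball.\<close>

lemma recurrent_center_least:
  assumes C: "center_of_attraction f x C"
  shows "recurrent_center x \<subseteq> C"
proof (rule ccontr)
  assume "\<not> recurrent_center x \<subseteq> C"
  then obtain y where y: "y \<in> recurrent_center x" "y \<notin> C" by blast
  have "open (- C)" using C by (auto simp: center_of_attraction_def)
  then obtain e where e: "e > 0" "ball y e \<subseteq> - C" using y(2) by (metis ComplI open_contains_ball)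
  let ?B = "ball y (e/2)"
  let ?N = "nbhd (e/2) C"
  have "z \<notin> ?B" if zN: "z \<in> ?N" for z
  proof
    assume z: "z \<in> ?B"
    obtain c where c: "c \<in> C" "dist c z < e/2" using zN unfolding nbhd_def by auto
    have "dist y c < e" using z c dist_triangle_half_r[of z y e c] by (auto simp: dist_commute)
    then show False using e c by auto
  qed
  then have disj: "?B \<inter> ?N = {}" by blast
  have le: "visit_freq x ?B T \<le> 1 - visit_freq x ?N T" if T: "T > 0" for T
  proof -
    let ?M = "\<lambda>U. {t \<in> {0..T}. f t x \<in> U}"
    have m: "?M ?B \<in> fmeasurable lborel" "?M ?N \<in> fmeasurable lborel"
      by (intro fmeasurable_visits open_nbhd open_ball)+
    have "measure lborel (?M ?B) + measure lborel (?M ?N) = measure lborel (?M ?B \<union> ?M ?N)"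
      using disj fmeasurableD2[OF m(1)] fmeasurableD2[OF m(2)]
      by (intro measure_Union[symmetric] fmeasurableD m) (auto simp: top.not_eq_extremum)
    also have "\<dots> \<le> measure lborel {0..T}"
      by (intro measure_mono_fmeasurable sets.Un fmeasurableD m fmeasurable_Icc) auto
    finally show ?thesis using T by (simp add: visit_freq_def divide_simps)
  qed
  have "negligible_visits x ?B"
    unfolding negligible_visits_def
  proof (rule tendsto_sandwich)
    show "\<forall>\<^sub>F T in at_top. 0 \<le> visit_freq x ?B T"
      using eventually_gt_at_top[of 0] by eventually_elim (use visit_freq_bounds in auto)
    show "\<forall>\<^sub>F T in at_top. visit_freq x ?B T \<le> 1 - visit_freq x ?N T"
      using eventually_gt_at_top[of 0] by eventually_elim (rule le)
    have "(visit_freq x ?N \<longlongrightarrow> 1) at_top" using C e by (simp add: center_of_attraction_iff)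
    then show "((\<lambda>T. 1 - visit_freq x ?N T) \<longlongrightarrow> 0) at_top"
      using tendsto_diff[OF tendsto_const, of "visit_freq x ?N" 1 _ 1] by simp
  qed simp
  then show False using y(1) e(1) by (auto simp: recurrent_center_def)
qed

text \<open>Being least among all centers of attraction gives both minimality and uniqueness, so the
  \<open>THE\<close> in \<open>minimal_center\<close> is resolved.\<close>

lemma minimal_center_eq: "minimal_center f x = recurrent_center x"
  unfolding minimal_center_def
proof (rule the_equality)
  show "is_minimal_center f x (recurrent_center x)"
    using center_of_attraction_recurrent_center recurrent_center_least
    unfolding is_minimal_center_def by blast
  show "C = recurrent_center x" if "is_minimal_center f x C" for C
    using that center_of_attraction_recurrent_center recurrent_center_least
    unfolding is_minimal_center_def by blast
qed

text \<open>A ball that the orbit never enters has negligible visits. This supplies the limit map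
  from \<open>x\<close> into \<open>\<Delta>\<close> required by
  \<open>Auslander_Ellis\<close>.\<close>

lemma minimal_center_subset_orbit_closure: "minimal_center f x \<subseteq> closure ((\<lambda>t. f t x) ` {0..})"
proof
  fix y assume "y \<in> minimal_center f x"
  then have y: "\<And>e. e > 0 \<Longrightarrow> \<not> negligible_visits x (ball y e)"
    by (simp add: minimal_center_eq recurrent_center_def)
  have "\<exists>t\<ge>0. dist (f t x) y < e" if "e > 0" for e
  proof (rule ccontr)
    assume "\<not> (\<exists>t\<ge>0. dist (f t x) y < e)"
    then have "negligible_visits x (ball y e)"
      by (intro negligible_visits_transfer[OF negligible_visits_empty, of _ 0 0])
        (auto simp: dist_commute)
    then show False using y that by blast
  qed
  then show "y \<in> closure ((\<lambda>t. f t x) ` {0..})" by (force simp: closure_approachable)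
qed

text \<open>By continuity of \<open>f t\<close>, visits to a small ball around \<open>y\<close>
  turn, \<open>t\<close> later, into visits to a given ball around \<open>f t y\<close>.\<close>

lemma flow_invariant_minimal_center: "flow_invariant f (minimal_center f x)"
  unfolding flow_invariant_def minimal_center_eq
proof (intro ballI allI impI)
  fix y and t :: real assume y: "y \<in> recurrent_center x" and t: "t \<ge> 0"
  have "\<not> negligible_visits x (ball (f t y) e)" if e: "e > 0" for e
  proof
    assume negl: "negligible_visits x (ball (f t y) e)"
    have "continuous (at y) (f t)"
      using continuous_on_time_map[OF t] by (simp add: continuous_on_eq_continuous_at)
    then obtain d where d: "d > 0" "\<And>z. dist z y < d \<Longrightarrow> dist (f t z) (f t y) < e"
      using e unfolding continuous_at_eps_delta by blast
    have "negligible_visits x (ball y d)"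
    proof (rule negligible_visits_transfer[OF negl, of _ 0 t])
      fix s :: real assume "s \<ge> 0" "f s x \<in> ball y d"
      then show "f (s + t) x \<in> ball (f t y) e"
        using d(2)[of "f s x"] t flow_add[of s t x] by (simp add: dist_commute)
    qed (use t in auto)
    then show False using y d(1) by (auto simp: recurrent_center_def)
  qed
  then show "f t y \<in> recurrent_center x" by (simp add: recurrent_center_def)
qed

section \<open>Asymptotic and proximal orbits\<close>

lemma minimal_center_mono_asymptotic:
  assumes "((\<lambda>t. dist (f t x) (f t y)) \<longlongrightarrow> 0) at_top"
  shows "minimal_center f x \<subseteq> minimal_center f y"
proof
  fix z assume z: "z \<in> minimal_center f x"
  have "\<not> negligible_visits y (ball z e)" if e: "e > 0" for e
  proof
    assume negl: "negligible_visits y (ball z e)"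
    have "\<forall>\<^sub>F t in at_top. dist (f t x) (f t y) < e/2"
      using order_tendstoD(2)[OF assms, of "e/2"] e by simp
    then obtain s0 where s0: "\<And>t. t \<ge> s0 \<Longrightarrow> dist (f t x) (f t y) < e/2"
      by (auto simp: eventually_at_top_linorder)
    \<comment> \<open>Past \<open>s0\<close>, a visit of \<open>x\<close> to the half ball is a
      visit of \<open>y\<close> to the full ball.\<close>
    have "negligible_visits x (ball z (e/2))"
    proof (rule negligible_visits_transfer[OF negl, of _ "max s0 0" 0])
      fix t assume "t \<ge> max s0 0" "f t x \<in> ball z (e/2)"
      then show "f (t + 0) y \<in> ball z e"
        using s0[of t] dist_triangle_half_r[of "f t x" z e "f t y"] by (auto simp: dist_commute)
    qed auto
    then show False using z e by (auto simp: minimal_center_eq recurrent_center_def)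
  qed
  then show "z \<in> minimal_center f y" by (simp add: minimal_center_eq recurrent_center_def)
qed

lemma minimal_center_eq_asymptotic:
  assumes "((\<lambda>t. dist (f t x) (f t y)) \<longlongrightarrow> 0) at_top"
  shows "minimal_center f x = minimal_center f y"
  using minimal_center_mono_asymptotic[of x y] minimal_center_mono_asymptotic[of y x] assms
  by (auto simp: dist_commute)

text \<open>Close times given by \<open>prox\<close> might all be early. But on a bounded time
  interval the distance has a positive minimum, unless the orbits meet, and then they agree forever
  after.\<close>

lemma frequently_close:
  assumes prox: "\<And>e. e > 0 \<Longrightarrow> \<exists>t\<ge>0. dist (f t x) (f t q) < e" and e: "e > 0"
  shows "\<exists>\<^sub>F t in at_top. dist (f t x) (f t q) < e"
  unfolding frequently_def
proof
  assume "\<forall>\<^sub>F t in at_top. \<not> dist (f t x) (f t q) < e"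
  then obtain N where N: "\<And>t. t \<ge> N \<Longrightarrow> dist (f t x) (f t q) \<ge> e"
    by (auto simp: eventually_at_top_linorder not_less)
  have ne: "f t x \<noteq> f t q" if "t \<ge> 0" for t
  proof
    assume "f t x = f t q"
    then have "f (t + max N 0) x = f (t + max N 0) q"
      using flow_add[of t "max N 0"] that by (metis max.cobounded2)
    moreover have "N \<le> t + max N 0" using that by simp
    ultimately show False using N[of "t + max N 0"] e by simp
  qed
  let ?K = "{0..max N 0}"
  have "continuous_on ?K (\<lambda>t. f t y)" for y
    by (rule continuous_on_subset[OF continuous_on_orbit]) auto
  then have "continuous_on ?K (\<lambda>t. dist (f t x) (f t q))"
    by (intro continuous_on_dist)
  moreover have "?K \<noteq> {}" by simp
  ultimately
  obtain s where s: "s \<in> ?K" "\<And>t. t \<in> ?K \<Longrightarrow> dist (f s x) (f s q) \<le> dist (f t x) (f t q)"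
    using continuous_attains_inf[OF compact_Icc] by blast
  \<comment> \<open>Below the minimum on \<open>?K\<close> the time must exceed \<open>N\<close>;
    below \<open>e\<close> it cannot.\<close>
  obtain t where "t \<ge> 0" "dist (f t x) (f t q) < min e (dist (f s x) (f s q))"
    using prox[of "min e (dist (f s x) (f s q))"] e ne[of s] s(1) by auto
  then show False using N[of t] s(2)[of t] by (cases "t \<ge> N") (simp_all add: max_def split: if_splits)
qed

end

theorem theorem3p1:
  fixes f :: "real \<Rightarrow> 'a::metric_space \<Rightarrow> 'a"
    and x :: 'a
    and \<Delta> :: "'a set"
  assumes "compact (UNIV :: 'a set)"
    and "semiflow f"
    and "\<not> generic_set f (minimal_center f x)"
    and "\<Delta> \<noteq> {}"
    and "closed \<Delta>"
    and "flow_invariant f \<Delta>"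
    and "\<Delta> \<subseteq> minimal_center f x"
  shows "\<exists>q\<in>\<Delta>. li_yorke_pair f x q"
proof -
  interpret compact_semiflow f using assms by unfold_locales
  have "\<Delta> \<inter> closure ((\<lambda>t. f t x) ` {0..}) \<noteq> {}"
    using assms minimal_center_subset_orbit_closure by blast
  then obtain q where q: "q \<in> \<Delta>" and prox: "\<And>e. e > 0 \<Longrightarrow> \<exists>t\<ge>0. dist (f t x) (f t q) < e"
    using Auslander_Ellis assms by blast
  let ?d = "\<lambda>t. ereal (dist (f t x) (f t q))"
  have nonneg: "0 \<le> Liminf at_top ?d" by (intro Liminf_bounded) simp
  have "Liminf at_top ?d = 0"
  proof (rule ccontr)
    assume "Liminf at_top ?d \<noteq> 0"
    then have "0 < Liminf at_top ?d" using nonneg by (simp add: order_less_le)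
    then obtain e where e: "0 < ereal e" "ereal e < Liminf at_top ?d"
      using ereal_dense2 by blast
    from less_LiminfD[OF e(2)] have "\<forall>\<^sub>F t in at_top. \<not> dist (f t x) (f t q) < e"
      by (rule eventually_mono) simp
    moreover have "\<exists>\<^sub>F t in at_top. dist (f t x) (f t q) < e"
      by (rule frequently_close[OF prox]) (use e in simp_all)
    ultimately show False by (simp add: frequently_def)
  qed
  moreover have "Limsup at_top ?d > 0"
  proof (rule ccontr)
    assume "\<not> Limsup at_top ?d > 0"
    \<comment> \<open>With lower limit 0, a nonpositive upper limit forces convergence.\<close>
    then have "(?d \<longlongrightarrow> 0) at_top"
      using \<open>Liminf at_top ?d = 0\<close> Liminf_le_Limsup[of "at_top :: real filter" ?d]
      by (intro Liminf_eq_Limsup) auto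
    then have "((\<lambda>t. dist (f t x) (f t q)) \<longlongrightarrow> 0) at_top" by (simp add: zero_ereal_def)
    then have "minimal_center f x = minimal_center f q" by (rule minimal_center_eq_asymptotic)
    \<comment> \<open>Here \<open>q\<close> lies in \<open>\<Delta>\<close>, hence in the minimal
      center of \<open>x\<close>, which is now its own: \<open>q\<close> witnesses
      genericity.\<close>
    then have "generic_set f (minimal_center f x)"
      using q assms(7) flow_invariant_minimal_center by (auto simp: generic_set_def)
    then show False using assms by blast
  qed
  ultimately show ?thesis using q unfolding li_yorke_pair_def by blast
qed

end
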